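(* Let $0<\sigma<1$. (i) Let $f\in\ell^2(\mathbb{Z})$ be real-valued with $f\ge 0$ and $f(n_0)=0$ for some $n_0\in\mathbb{Z}$. Then $(-\Delta_{\mathrm d})^\sigma f(n_0)\le 0$. Moreover, $(-\Delta_{\mathrm d})^\sigma f(n_0)=0$ only if $f(n)=0$ for all $n\in\mathbb{Z}$. (ii) Let $f,g\in\ell^2(\mathbb{Z})$ be real-valued with $f\ge g$ and $f(n_0)=g(n_0)$ at some $n_0\in\mathbb{Z}$. Then $(-\Delta_{\mathrm d})^\sigma f(n_0)\le(-\Delta_{\mathrm d})^\sigma g(n_0)$. Moreover, $(-\Delta_{\mathrm d})^\sigma f(n_0)=(-\Delta_{\mathrm d})^\sigma g(n_0)$ only if $f(n)=g(n)$ for all $n\in\mathbb{Z}$.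
   Context: The discrete Laplacian is $\Delta_{\mathrm d}f(n)=f(n+1)-2f(n)+f(n-1)$, $n\in\mathbb{Z}$. For $k\in\mathbb{Z}$, $I_k(t)=\sum_{m=0}^\infty\frac{1}{m!\,\Gamma(m+k+1)}\left(\frac t2\right)^{2m+k}$ is the modified Bessel function of the first kind (with $1/\Gamma(j)=0$ for $j=0,-1,-2,\dots$). The discrete heat semigroup is $W_tf(n)=e^{t\Delta_{\mathrm d}}f(n)=\sum_{m\in\mathbb{Z}}e^{-2t}I_{n-m}(2t)f(m)$, $t\ge0$. For $0<\sigma<1$ the discrete fractional Laplacian is defined, for $f\in\ell^2(\mathbb{Z})$, by $$(-\Delta_{\mathrm d})^\sigma f(n)=\frac{1}{\Gamma(-\sigma)}\int_0^\infty\left(e^{t\Delta_{\mathrm d}}f(n)-f(n)\right)\frac{dt}{t^{1+\sigma}},\quad n\in\mathbb{Z}.$$ Inequalities between sequences are pointwise. *)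

theory Defs
  imports "HOL-Analysis.Analysis"
begin

text \<open>
  \<^const>\<open>rGamma\<close> is the entire extension of the reciprocal Gamma function, so the terms with
  \<open>m + k + 1 \<le> 0\<close> vanish; these include all terms with a negative exponent.
\<close>

definition bessel_I :: "int \<Rightarrow> real \<Rightarrow> real" where
  "bessel_I k t =
     (\<Sum>m. rGamma (of_int (int m + k + 1)) / fact m * (t / 2) powi (2 * int m + k))"

definition ell2 :: "(int \<Rightarrow> real) set" where
  "ell2 = {f. (\<lambda>n. (f n)\<^sup>2) summable_on UNIV}"

definition heat_semigroup :: "real \<Rightarrow> (int \<Rightarrow> real) \<Rightarrow> int \<Rightarrow> real" where
  "heat_semigroup t f n =
     (\<Sum>\<^sub>\<infinity>m\<in>UNIV. exp (- 2 * t) * bessel_I (n - m) (2 * t) * f m)"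

text \<open>
  The integral is a Lebesgue integral; for \<open>f\<close> in \<^const>\<open>ell2\<close> and \<open>0 < \<sigma> < 1\<close> it converges
  absolutely, since \<open>heat_semigroup t f n - f n\<close> is bounded in \<open>t\<close> and \<open>O(t)\<close> as \<open>t\<close> tends to \<open>0\<close>.
\<close>

definition frac_laplacian :: "real \<Rightarrow> (int \<Rightarrow> real) \<Rightarrow> int \<Rightarrow> real" where
  "frac_laplacian \<sigma> f n =
     1 / Gamma (- \<sigma>) *
     (LINT t:{0<..}|lborel. (heat_semigroup t f n - f n) / t powr (1 + \<sigma>))"

end

theory Submission
  imports Defs
begin

text \<open>
  The heat semigroup is convolution with the kernel \<open>K\<^sub>t(k) = e\<^bsup>-2t\<^esup> I\<^sub>k(2t)\<close>, which for \<open>t > 0\<close> is a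
  strictly positive probability distribution on the integers. Positivity holds because the Bessel
  series has nonnegative terms that are not all zero (\<open>heat_kernel_pos\<close>); total mass one is the
  identity \<open>\<Sum>\<^sub>k I\<^sub>k(2t) = e\<^bsup>2t\<^esup>\<close>, obtained by multiplying two exponential series and grouping the
  products by the difference of their exponents (\<open>heat_kernel_has_sum_1\<close>).

  If \<open>h \<ge> 0\<close> vanishes at \<open>n\<^sub>0\<close>, then \<open>W\<^sub>t h(n\<^sub>0) - h(n\<^sub>0) = \<Sum>\<^sub>m K\<^sub>t(n\<^sub>0 - m) h(m) \<ge> 0\<close> for every \<open>t > 0\<close>, and
  \<open>\<Gamma>(-\<sigma>) < 0\<close> gives the sign of the fractional Laplacian. If the fractional Laplacian vanishes,
  so does the integrand for almost every \<open>t\<close>; a single such \<open>t > 0\<close> makes a sum of nonnegative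
  terms zero, and positivity of the kernel forces every \<open>h(m)\<close> to be zero
  (\<open>frac_laplacian_at_zero_minimum\<close>).

  Both deducing \<open>F = 0\<close> almost everywhere from a zero integral of \<open>F \<ge> 0\<close>, and passing to a
  difference \<open>h = f - g\<close> in the comparison statement, rest on absolute convergence of the defining
  integral (\<open>heat_increment_set_integrable\<close>). Since the kernel has mass one and
  \<open>K\<^sub>t(0) \<ge> e\<^bsup>-2t\<^esup>\<close>, a sequence bounded by \<open>M\<close> satisfies
  \<open>\<bar>W\<^sub>t f(n) - f(n)\<bar> \<le> 2 M (1 - K\<^sub>t(0)) \<le> 2 M min(1, 2t)\<close>, and \<open>min(1, 2t) / t\<^bsup>1+\<sigma>\<^esup>\<close> is integrable
  on the half-line for \<open>0 < \<sigma> < 1\<close>. Square-summable sequences are bounded, so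
  these estimates apply to them.
\<close>

section \<open>Sums over products\<close>

lemma has_sum_diff_real:
  fixes f g :: "'a \<Rightarrow> real"
  assumes "(f has_sum a) A" and "(g has_sum b) A"
  shows "((\<lambda>x. f x - g x) has_sum a - b) A"
  using has_sum_add[OF assms(1), of "\<lambda>x. - g x" "- b"] assms(2) by (simp add: has_sum_uminus)

lemma has_sum_mult_nonneg:
  fixes f :: "'a \<Rightarrow> real" and g :: "'b \<Rightarrow> real"
  assumes f: "(f has_sum a) A" and g: "(g has_sum b) B"
    and "\<And>x. x \<in> A \<Longrightarrow> 0 \<le> f x" and "\<And>y. y \<in> B \<Longrightarrow> 0 \<le> g y"
  shows "((\<lambda>(x, y). f x * g y) has_sum a * b) (A \<times> B)"
proof (rule has_sum_SigmaI)
  show "((\<lambda>y. case (x, y) of (x, y) \<Rightarrow> f x * g y) has_sum f x * b) B" if "x \<in> A" for x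
    using has_sum_cmult_right[OF g] by simp
  show "((\<lambda>x. f x * b) has_sum a * b) A"
    by (rule has_sum_cmult_left[OF f])
  show "(\<lambda>(x, y). f x * g y) summable_on A \<times> B"
  proof (rule summable_on_SigmaI)
    show "((\<lambda>y. case (x, y) of (x, y) \<Rightarrow> f x * g y) has_sum f x * b) B" if "x \<in> A" for x
      using has_sum_cmult_right[OF g] by simp
    show "(\<lambda>x. f x * b) summable_on A"
      using has_sum_cmult_left[OF f] by (rule has_sum_imp_summable)
  qed (use assms in auto)
qed

lemma has_sum_exp:
  fixes x :: real
  assumes "0 \<le> x"
  shows "((\<lambda>n. x ^ n / fact n) has_sum exp x) UNIV"
  using sums_nonneg_imp_has_sum[OF exp_converges, of x] assms
  by (simp add: divide_inverse mult.commute)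

section \<open>The Bessel series\<close>

text \<open>
  The \<open>m\<close>-th term of the series of \<open>I\<^sub>k(2y)\<close>, split as the product of the \<open>m\<close>-th and the \<open>(m+k)\<close>-th
  term of the exponential series at \<open>y\<close>. This is the form in which the generating identity for
  the Bessel functions becomes a rearrangement of \<open>e\<^sup>y e\<^sup>y\<close>.
\<close>
definition bessel_term :: "int \<Rightarrow> real \<Rightarrow> nat \<Rightarrow> real" where
  "bessel_term k y m =
     (if 0 \<le> int m + k then y ^ m / fact m * (y ^ nat (int m + k) / fact (nat (int m + k))) else 0)"

lemma bessel_term_nonneg: "0 \<le> y \<Longrightarrow> 0 \<le> bessel_term k y m"
  by (simp add: bessel_term_def)

lemma bessel_I_eq_suminf: "bessel_I k (2 * y) = (\<Sum>m. bessel_term k y m)"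
proof -
  have "rGamma (of_int (int m + k + 1)) / fact m * y powi (2 * int m + k) = bessel_term k y m" for m
  proof (cases "0 \<le> int m + k")
    case True
    define j where "j = nat (int m + k)"
    have j: "k = int j - int m"
      using True by (simp add: j_def)
    have "rGamma (of_int (int m + k + 1)) = (1 / fact j :: real)"
      unfolding rGamma_inverse_Gamma Gamma_of_int
      using True by (auto simp: j_def divide_inverse)
    moreover have "y powi (2 * int m + k) = y ^ (m + j)"
    proof -
      have "2 * int m + k = int (m + j)"
        by (simp add: j)
      then show ?thesis
        by (simp only: power_int_of_nat)
    qed
    ultimately show ?thesis
      using True by (simp add: bessel_term_def power_add flip: j_def)
  next
    case False
    then show ?thesis
      by (simp add: bessel_term_def rGamma_inverse_Gamma Gamma_of_int del: of_int_add)
  qed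
  then show ?thesis
    by (simp add: bessel_I_def)
qed

text \<open>
  The pairs \<open>(k, m)\<close> with \<open>m + k \<ge> 0\<close> correspond bijectively to the pairs \<open>(m, j)\<close> of naturals through
  \<open>j = m + k\<close>, so this is the double series of \<open>e\<^sup>y e\<^sup>y\<close> grouped by \<open>k = j - m\<close>; the terms with
  \<open>m + k < 0\<close> are zero.
\<close>
lemma has_sum_bessel_term:
  assumes "0 \<le> y"
  shows "((\<lambda>(k, m). bessel_term k y m) has_sum exp (2 * y)) (UNIV \<times> UNIV)"
proof -
  have "((\<lambda>(m, j). y ^ m / fact m * (y ^ j / fact j)) has_sum exp y * exp y) (UNIV \<times> UNIV)"
    using assms by (intro has_sum_mult_nonneg has_sum_exp) auto
  then have "((\<lambda>(k, m). bessel_term k y m) has_sum exp y * exp y) {(k, m). 0 \<le> int m + k}"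
    by (rule has_sum_reindex_bij_witness[of _ "\<lambda>(m, j). (int j - int m, m)"
          "\<lambda>(k, m). (m, nat (int m + k))", THEN iffD2, rotated -1])
      (auto simp: bessel_term_def)
  then have "((\<lambda>(k, m). bessel_term k y m) has_sum exp y * exp y) (UNIV \<times> UNIV)"
    by (rule has_sum_cong_neutral[THEN iffD1, rotated -1]) (auto simp: bessel_term_def)
  then show ?thesis
    by (simp flip: exp_add)
qed

lemma bessel_I_has_sum:
  assumes "0 \<le> y"
  shows "(bessel_term k y has_sum bessel_I k (2 * y)) UNIV"
proof -
  have "bessel_term k y summable_on UNIV"
    by (rule summable_on_SigmaD1[OF has_sum_imp_summable[OF has_sum_bessel_term[OF assms]]]) simp
  then have s: "(bessel_term k y has_sum infsum (bessel_term k y) UNIV) UNIV"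
    by (rule has_sum_infsum)
  then show ?thesis
    using has_sum_imp_sums[OF s] by (simp add: bessel_I_eq_suminf sums_iff)
qed

section \<open>The heat kernel\<close>

definition heat_kernel :: "real \<Rightarrow> int \<Rightarrow> real" where
  "heat_kernel t k = exp (- 2 * t) * bessel_I k (2 * t)"

lemma heat_kernel_has_sum_1:
  assumes "0 \<le> t"
  shows "(heat_kernel t has_sum 1) UNIV"
proof -
  have "((\<lambda>k. bessel_I k (2 * t)) has_sum exp (2 * t)) UNIV"
    using has_sum_SigmaD[OF has_sum_bessel_term[OF assms], of "\<lambda>k. bessel_I k (2 * t)"]
      bessel_I_has_sum[OF assms] by simp
  from has_sum_cmult_right[OF this, of "exp (- 2 * t)"] show ?thesis
    by (simp add: heat_kernel_def[abs_def] flip: exp_add)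
qed

lemma heat_kernel_shift_has_sum_1:
  assumes "0 \<le> t"
  shows "((\<lambda>m. heat_kernel t (n - m)) has_sum 1) UNIV"
  using heat_kernel_has_sum_1[OF assms]
  by (subst has_sum_reindex_bij_witness[of _ "\<lambda>k. n - k" "\<lambda>m. n - m" _ "heat_kernel t"]) auto

lemma bessel_term_le_bessel_I:
  assumes "0 \<le> y"
  shows "bessel_term k y m \<le> bessel_I k (2 * y)"
  using finite_sum_le_has_sum[OF bessel_I_has_sum[OF assms], of "{m}"] bessel_term_nonneg[OF assms]
  by simp

lemma heat_kernel_pos:
  assumes "0 < t"
  shows "0 < heat_kernel t k"
proof -
  \<comment> \<open>The index must satisfy \<open>m + k \<ge> 0\<close> for its term to be nonzero; \<open>m = \<bar>k\<bar>\<close> does for either sign of \<open>k\<close>.\<close>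
  have "0 < bessel_term k t (nat \<bar>k\<bar>)"
    using assms by (simp add: bessel_term_def)
  also have "\<dots> \<le> bessel_I k (2 * t)"
    using assms by (intro bessel_term_le_bessel_I) simp
  finally show ?thesis
    by (simp add: heat_kernel_def)
qed

text \<open>
  The leading term of \<open>I\<^sub>0\<close> is \<open>1\<close>, so \<open>K\<^sub>t(0) \<ge> e\<^bsup>-2t\<^esup>\<close>. Read as \<open>1 - K\<^sub>t(0) \<le> min(1, 2t)\<close>, this bounds the mass
  that has left the origin by time \<open>t\<close>, and so the increment of the semigroup at small times.
\<close>
lemma heat_kernel_0_ge:
  assumes "0 \<le> t"
  shows "1 - min 1 (2 * t) \<le> heat_kernel t 0"
proof -
  have I: "1 \<le> bessel_I 0 (2 * t)"
    using bessel_term_le_bessel_I[OF assms, of 0 0] by (simp add: bessel_term_def)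
  have "1 - min 1 (2 * t) \<le> exp (- 2 * t)"
    using exp_ge_add_one_self[of "- 2 * t"] by (auto simp: min_def)
  also have "\<dots> \<le> exp (- 2 * t) * bessel_I 0 (2 * t)"
    using I by simp
  finally show ?thesis
    by (simp add: heat_kernel_def)
qed

section \<open>The heat semigroup on bounded sequences\<close>

lemma ell2_bounded:
  assumes "f \<in> ell2"
  obtains M where "\<And>n. \<bar>f n\<bar> \<le> M"
proof
  have s: "(\<lambda>n. (f n)\<^sup>2) summable_on UNIV"
    using assms by (simp add: ell2_def)
  show "\<bar>f n\<bar> \<le> sqrt (\<Sum>\<^sub>\<infinity>n. (f n)\<^sup>2)" for n
    using finite_sum_le_infsum[OF s, of "{n}"] by (intro real_le_rsqrt) simp
qed

lemma heat_semigroup_has_sum: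
  assumes "0 < t" and bnd: "\<And>n. \<bar>f n\<bar> \<le> M"
  shows "((\<lambda>m. heat_kernel t (n - m) * f m) has_sum heat_semigroup t f n) UNIV"
proof -
  have k: "((\<lambda>m. heat_kernel t (n - m)) has_sum 1) UNIV"
    using assms(1) by (intro heat_kernel_shift_has_sum_1) simp
  have "(\<lambda>m. norm (heat_kernel t (n - m) * f m)) summable_on UNIV"
  proof (rule summable_on_comparison_test)
    show "(\<lambda>m. heat_kernel t (n - m) * M) summable_on UNIV"
      using has_sum_cmult_left[OF k] by (rule has_sum_imp_summable)
    show "norm (heat_kernel t (n - m) * f m) \<le> heat_kernel t (n - m) * M" for m
      using heat_kernel_pos[OF assms(1), of "n - m"] bnd[of m]
      by (simp add: abs_mult mult_left_mono)
  qed auto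
  then have "(\<lambda>m. heat_kernel t (n - m) * f m) summable_on UNIV"
    by (rule abs_summable_summable)
  then show ?thesis
    by (simp add: heat_semigroup_def heat_kernel_def)
qed

text \<open>
  Since the kernel has mass one, the increment is \<open>\<Sum>\<^sub>m K\<^sub>t(n - m) (f(m) - f(n))\<close>. Its term at
  \<open>m = n\<close> vanishes, the differences are at most \<open>2 M\<close>, and the remaining mass is \<open>1 - K\<^sub>t(0)\<close>.
\<close>
lemma heat_semigroup_increment_bound:
  assumes "0 < t" and bnd: "\<And>n. \<bar>f n\<bar> \<le> M"
  shows "\<bar>heat_semigroup t f n - f n\<bar> \<le> 2 * M * min 1 (2 * t)"
proof -
  have k: "((\<lambda>m. heat_kernel t (n - m)) has_sum 1) UNIV"
    using assms(1) by (intro heat_kernel_shift_has_sum_1) simp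
  have M: "0 \<le> M"
    using bnd[of 0] by simp
  have "((\<lambda>m. heat_kernel t (n - m) * f m - heat_kernel t (n - m) * f n) has_sum
      heat_semigroup t f n - 1 * f n) UNIV"
    by (intro has_sum_diff_real heat_semigroup_has_sum[OF assms] has_sum_cmult_left k)
  then have inc: "((\<lambda>m. heat_kernel t (n - m) * (f m - f n)) has_sum
      heat_semigroup t f n - f n) UNIV"
    by (simp add: right_diff_distrib)
  have "((\<lambda>m. heat_kernel t (n - m)) has_sum 1 - heat_kernel t 0) (UNIV - {n})"
    using has_sum_Diff[OF k, of "{n}" "heat_kernel t 0"] has_sum_finite[of "{n}" "\<lambda>m. heat_kernel t (n - m)"]
    by simp
  from has_sum_cmult_left[OF this, of "2 * M"]
  have off: "((\<lambda>m. heat_kernel t (n - m) * (2 * M)) has_sum (1 - heat_kernel t 0) * (2 * M)) (UNIV - {n})" .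
  have "norm (heat_semigroup t f n - f n) \<le> (1 - heat_kernel t 0) * (2 * M)"
  proof (rule norm_infsum_le)
    show "((\<lambda>m. heat_kernel t (n - m) * (f m - f n)) has_sum
      heat_semigroup t f n - f n) (UNIV - {n})"
      by (rule has_sum_cong_neutral[THEN iffD1, OF _ _ _ inc]) auto
    show "norm (heat_kernel t (n - m) * (f m - f n)) \<le> heat_kernel t (n - m) * (2 * M)" for m
      using heat_kernel_pos[OF assms(1), of "n - m"] bnd[of m] bnd[of n]
      by (simp add: abs_mult mult_left_mono)
  qed (rule off)
  also have "\<dots> \<le> min 1 (2 * t) * (2 * M)"
    using heat_kernel_0_ge[of t] assms(1) M by (intro mult_right_mono) auto
  finally show ?thesis
    by (simp add: mult.commute)
qed

section \<open>Absolute convergence of the defining integral\<close>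

lemma bessel_I_measurable [measurable]: "bessel_I k \<in> borel_measurable borel"
proof -
  have "bessel_I k = (\<lambda>t. \<Sum>m. bessel_term k (t / 2) m)"
    using bessel_I_eq_suminf[of k "t / 2" for t] by auto
  moreover have "(\<lambda>t. bessel_term k (t / 2) m) \<in> borel_measurable borel" for m
    unfolding bessel_term_def by measurable
  ultimately show ?thesis
    by simp
qed

text \<open>
  The integrand is \<open>2 t\<^bsup>-\<sigma>\<^esup>\<close> or less near \<open>0\<close>, integrable as \<open>\<sigma> < 1\<close>, and at most \<open>t\<^bsup>-1-\<sigma>\<^esup>\<close> near infinity,
  integrable as \<open>\<sigma> > 0\<close>. The two open intervals miss only the point \<open>1\<close>.
\<close>
lemma set_integrable_min_powr:
  fixes \<sigma> :: real
  assumes "0 < \<sigma>" and "\<sigma> < 1"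
  shows "set_integrable lborel {0<..} (\<lambda>t. min 1 (2 * t) / t powr (1 + \<sigma>))" (is "set_integrable _ _ ?h")
proof -
  have meas: "?h \<in> borel_measurable borel"
    by measurable
  have near: "set_integrable lborel (einterval 0 1) (\<lambda>t. 2 * t powr - \<sigma>)"
  proof (rule interval_integral_FTC_nonneg(1)[where F = "\<lambda>t. 2 * t powr (1 - \<sigma>) / (1 - \<sigma>)"])
    show "((\<lambda>t. 2 * t powr (1 - \<sigma>) / (1 - \<sigma>)) has_real_derivative 2 * x powr - \<sigma>) (at x)"
      if "0 < ereal x" "ereal x < 1" for x
      using that assms by (auto intro!: derivative_eq_intros)
    show "isCont (\<lambda>t. 2 * t powr - \<sigma>) x" if "0 < ereal x" "ereal x < 1" for x
      using that by (auto intro!: continuous_intros)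
    show "(((\<lambda>t. 2 * t powr (1 - \<sigma>) / (1 - \<sigma>)) \<circ> real_of_ereal) \<longlongrightarrow> 0) (at_right 0)"
      unfolding zero_ereal_def ereal_tendsto_simps
      using assms by (auto intro!: tendsto_eq_intros eventually_at_right_less simp: eventually_at_filter)
    show "(((\<lambda>t. 2 * t powr (1 - \<sigma>) / (1 - \<sigma>)) \<circ> real_of_ereal) \<longlongrightarrow> 2 / (1 - \<sigma>)) (at_left 1)"
      unfolding one_ereal_def ereal_tendsto_simps
      using assms by (auto intro!: tendsto_eq_intros)
  qed auto
  have far: "set_integrable lborel (einterval 1 \<infinity>) (\<lambda>t. t powr (- \<sigma> - 1))"
  proof (rule interval_integral_FTC_nonneg(1)[where F = "\<lambda>t. - (t powr - \<sigma>) / \<sigma>"])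
    show "((\<lambda>t. - (t powr - \<sigma>) / \<sigma>) has_real_derivative x powr (- \<sigma> - 1)) (at x)"
      if "1 < ereal x" "ereal x < \<infinity>" for x
      using that assms by (auto intro!: derivative_eq_intros simp: algebra_simps)
    show "isCont (\<lambda>t. t powr (- \<sigma> - 1)) x" if "1 < ereal x" "ereal x < \<infinity>" for x
      using that by (auto intro!: continuous_intros)
    show "(((\<lambda>t. - (t powr - \<sigma>) / \<sigma>) \<circ> real_of_ereal) \<longlongrightarrow> - 1 / \<sigma>) (at_right 1)"
      unfolding one_ereal_def ereal_tendsto_simps
      using assms by (auto intro!: tendsto_eq_intros)
    have "((\<lambda>t. - (t powr - \<sigma>) / \<sigma>) \<longlongrightarrow> - 0 / \<sigma>) at_top"
      using assms by (intro tendsto_intros tendsto_neg_powr filterlim_ident) auto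
    then show "(((\<lambda>t. - (t powr - \<sigma>) / \<sigma>) \<circ> real_of_ereal) \<longlongrightarrow> 0) (at_left \<infinity>)"
      unfolding ereal_tendsto_simps by simp
  qed auto
  have "set_integrable lborel (einterval 0 1) ?h"
  proof (rule set_integrable_bound[OF near])
    show "AE t in lborel. t \<in> einterval 0 1 \<longrightarrow> norm (?h t) \<le> norm (2 * t powr - \<sigma>)"
      by (intro AE_I2) (auto simp: einterval_def powr_add powr_minus field_simps)
  qed (use meas in \<open>simp add: set_borel_measurable_def\<close>)
  moreover have "set_integrable lborel (einterval 1 \<infinity>) ?h"
  proof (rule set_integrable_bound[OF far])
    show "AE t in lborel. t \<in> einterval 1 \<infinity> \<longrightarrow> norm (?h t) \<le> norm (t powr (- \<sigma> - 1))"
      by (intro AE_I2) (auto simp: einterval_def powr_add powr_diff powr_minus field_simps)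
  qed (use meas in \<open>simp add: set_borel_measurable_def\<close>)
  ultimately have "set_integrable lborel (einterval 0 1 \<union> einterval 1 \<infinity>) ?h"
    by (rule set_integrable_Un) auto
  moreover have "AE t in lborel. indicator {0<..} t *\<^sub>R ?h t = indicator (einterval 0 1 \<union> einterval 1 \<infinity>) t *\<^sub>R ?h t"
    using AE_lborel_singleton[of "1::real"]
    by eventually_elim (auto simp: einterval_def indicator_def)
  ultimately show ?thesis
    unfolding set_integrable_def
    by (subst integrable_cong_AE[OF _ _ \<open>AE t in lborel. _ t\<close>]) (use meas in auto)
qed

lemma heat_increment_set_integrable:
  assumes "0 < \<sigma>" and "\<sigma> < 1" and bnd: "\<And>n. \<bar>f n\<bar> \<le> M"
  shows "set_integrable lborel {0<..} (\<lambda>t. (heat_semigroup t f n - f n) / t powr (1 + \<sigma>))"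
proof (rule set_integrable_bound)
  show "set_integrable lborel {0<..} (\<lambda>t. 2 * M * (min 1 (2 * t) / t powr (1 + \<sigma>)))"
    using set_integrable_min_powr[OF assms(1,2)] by (intro set_integrable_mult_right) simp
  show "AE t in lborel. t \<in> {0<..} \<longrightarrow>
      norm ((heat_semigroup t f n - f n) / t powr (1 + \<sigma>)) \<le> norm (2 * M * (min 1 (2 * t) / t powr (1 + \<sigma>)))"
  proof (intro AE_I2 impI)
    fix t :: real assume "t \<in> {0<..}"
    then have "\<bar>heat_semigroup t f n - f n\<bar> \<le> \<bar>2 * M * min 1 (2 * t)\<bar>"
      using heat_semigroup_increment_bound[of t f M n] bnd by (simp add: order.trans)
    then show "norm ((heat_semigroup t f n - f n) / t powr (1 + \<sigma>)) \<le> norm (2 * M * (min 1 (2 * t) / t powr (1 + \<sigma>)))"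
      by (simp add: divide_right_mono)
  qed
  \<comment> \<open>Measurability in \<open>t\<close> is inherited from a countable series, so the sum over the integers is enumerated.
    The two agree only where the sum converges, which is guaranteed for \<open>t > 0\<close>.\<close>
  define W where "W t = (\<Sum>i. heat_kernel t (n - int_decode i) * f (int_decode i))" for t
  have W: "heat_semigroup t f n = W t" if "0 < t" for t
  proof -
    have "((\<lambda>i. heat_kernel t (n - int_decode i) * f (int_decode i)) has_sum heat_semigroup t f n) UNIV"
      using heat_semigroup_has_sum[of t f M n] that bnd
      by (subst has_sum_reindex_bij_betw[OF bij_int_decode]) auto
    from has_sum_imp_sums[OF this] show ?thesis
      by (simp add: W_def sums_iff)
  qed
  have [measurable]: "W \<in> borel_measurable borel"
    unfolding W_def heat_kernel_def by measurable
  have "(\<lambda>t. indicator {0<..} t *\<^sub>R ((W t - f n) / t powr (1 + \<sigma>))) \<in> borel_measurable borel"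
    by measurable
  also have "(\<lambda>t. indicator {0<..} t *\<^sub>R ((W t - f n) / t powr (1 + \<sigma>))) =
      (\<lambda>t. indicator {0<..} t *\<^sub>R ((heat_semigroup t f n - f n) / t powr (1 + \<sigma>)))"
    by (auto simp: indicator_def W)
  finally show "set_borel_measurable lborel {0<..} (\<lambda>t. (heat_semigroup t f n - f n) / t powr (1 + \<sigma>))"
    by (simp add: set_borel_measurable_def)
qed

section \<open>The maximum principle\<close>

lemma Gamma_neg_of_mem_Ioo:
  fixes \<sigma> :: real
  assumes "0 < \<sigma>" and "\<sigma> < 1"
  shows "Gamma (- \<sigma>) < 0"
proof -
  have "- \<sigma> \<notin> \<int>\<^sub>\<le>\<^sub>0"
  proof
    assume "- \<sigma> \<in> \<int>\<^sub>\<le>\<^sub>0"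
    then obtain j :: int where j: "- \<sigma> = of_int j"
      by (auto elim!: nonpos_Ints_cases)
    then have "of_int (- 1) < (of_int j :: real)" and "(of_int j :: real) < of_int 0"
      using assms by simp_all
    then show False
      unfolding of_int_less_iff by simp
  qed
  then have "Gamma (1 - \<sigma>) = - \<sigma> * Gamma (- \<sigma>)"
    using Gamma_plus1[of "- \<sigma>"] by simp
  moreover have "0 < Gamma (1 - \<sigma>)"
    using assms by (intro Gamma_real_pos) simp
  ultimately show ?thesis
    using assms by (simp add: mult_less_0_iff)
qed

lemma frac_laplacian_diff:
  assumes "0 < \<sigma>" and "\<sigma> < 1" and f: "\<And>n. \<bar>f n\<bar> \<le> M" and g: "\<And>n. \<bar>g n\<bar> \<le> N"
  shows "frac_laplacian \<sigma> (\<lambda>m. f m - g m) n = frac_laplacian \<sigma> f n - frac_laplacian \<sigma> g n"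
proof -
  have "heat_semigroup t (\<lambda>m. f m - g m) n = heat_semigroup t f n - heat_semigroup t g n"
    if "0 < t" for t
  proof -
    have "((\<lambda>m. heat_kernel t (n - m) * f m - heat_kernel t (n - m) * g m) has_sum
        heat_semigroup t f n - heat_semigroup t g n) UNIV"
      using that f g by (intro has_sum_diff_real heat_semigroup_has_sum) auto
    from infsumI[OF this] show ?thesis
      unfolding heat_semigroup_def heat_kernel_def by (simp only: right_diff_distrib)
  qed
  then have "(LINT t:{0<..}|lborel. (heat_semigroup t (\<lambda>m. f m - g m) n - (f n - g n)) / t powr (1 + \<sigma>)) =
      (LINT t:{0<..}|lborel. (heat_semigroup t f n - f n) / t powr (1 + \<sigma>) -
        (heat_semigroup t g n - g n) / t powr (1 + \<sigma>))"
    by (intro set_lebesgue_integral_cong) (auto simp: diff_divide_distrib)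
  also have "\<dots> = (LINT t:{0<..}|lborel. (heat_semigroup t f n - f n) / t powr (1 + \<sigma>)) -
      (LINT t:{0<..}|lborel. (heat_semigroup t g n - g n) / t powr (1 + \<sigma>))"
    by (intro set_integral_diff heat_increment_set_integrable[OF assms(1,2) f]
        heat_increment_set_integrable[OF assms(1,2) g])
  finally show ?thesis
    by (simp add: frac_laplacian_def right_diff_distrib)
qed

text \<open>
  At a zero of \<open>h \<ge> 0\<close> the integrand is a nonnegative combination, with strictly positive weights,
  of all the values of \<open>h\<close>. This nonlocality is why vanishing at one point of the lattice forces \<open>h\<close>
  to vanish everywhere.
\<close>
lemma frac_laplacian_at_zero_minimum:
  assumes "0 < \<sigma>" and "\<sigma> < 1" and bnd: "\<And>n. \<bar>h n\<bar> \<le> M"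
    and nonneg: "\<And>n. 0 \<le> h n" and zero: "h n0 = 0"
  shows "frac_laplacian \<sigma> h n0 \<le> 0"
    and "frac_laplacian \<sigma> h n0 = 0 \<Longrightarrow> h n = 0"
proof -
  define F where "F t = indicator {0<..} t *\<^sub>R ((heat_semigroup t h n0 - h n0) / t powr (1 + \<sigma>))" for t :: real
  have sum: "((\<lambda>m. heat_kernel t (n0 - m) * h m) has_sum heat_semigroup t h n0) UNIV" if "0 < t" for t
    using heat_semigroup_has_sum[of t h M n0] that bnd by simp
  have terms_nonneg: "0 \<le> heat_kernel t (n0 - m) * h m" if "0 < t" for t m
    using heat_kernel_pos[OF that, of "n0 - m"] nonneg by simp
  have F_nonneg: "0 \<le> F t" for t
    using has_sum_nonneg[OF sum] terms_nonneg by (auto simp: F_def indicator_def zero)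
  have F_integrable: "integrable lborel F"
    using heat_increment_set_integrable[OF assms(1-3)]
    unfolding set_integrable_def F_def .
  have eq: "frac_laplacian \<sigma> h n0 = 1 / Gamma (- \<sigma>) * integral\<^sup>L lborel F"
    by (simp add: frac_laplacian_def set_lebesgue_integral_def F_def[abs_def])
  have Gneg: "Gamma (- \<sigma>) < 0"
    by (rule Gamma_neg_of_mem_Ioo[OF assms(1,2)])
  have "0 \<le> integral\<^sup>L lborel F"
    using F_nonneg by simp
  then show "frac_laplacian \<sigma> h n0 \<le> 0"
    using Gneg by (simp add: eq divide_nonneg_neg)
  assume "frac_laplacian \<sigma> h n0 = 0"
  then have "integral\<^sup>L lborel F = 0"
    using Gneg by (simp add: eq)
  then have "AE t in lborel. F t = 0"
    using integral_nonneg_eq_0_iff_AE[OF F_integrable] F_nonneg by simp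
  \<comment> \<open>The exceptional null set cannot contain \<open>(0,1)\<close>, so some \<open>t > 0\<close> lies outside it.\<close>
  moreover have "\<not> (AE t in lborel. \<not> (0 < t \<and> t < (1::real)))"
  proof
    assume "AE t in lborel. \<not> (0 < t \<and> t < (1::real))"
    then have "emeasure lborel {0<..<1::real} = 0"
      by (subst (asm) AE_iff_measurable[where N = "{0<..<1}"]) auto
    then show False
      by simp
  qed
  ultimately obtain t where t: "0 < t" "F t = 0"
    by (metis (mono_tags, lifting) AE_mp AE_I2)
  then have "heat_semigroup t h n0 = 0"
    by (simp add: F_def zero)
  then have "heat_kernel t (n0 - n) * h n = 0"
    using nonneg_has_sum_le_0D[OF sum[OF t(1)]] terms_nonneg[OF t(1)] by simp
  then show "h n = 0"
    using heat_kernel_pos[OF t(1), of "n0 - n"] by simp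
qed

theorem theorem1:
  fixes \<sigma> :: real
  assumes "0 < \<sigma>" and "\<sigma> < 1"
  shows "(\<forall>f n0. f \<in> ell2 \<longrightarrow> (\<forall>n. 0 \<le> f n) \<longrightarrow> f n0 = 0 \<longrightarrow>
            frac_laplacian \<sigma> f n0 \<le> 0 \<and>
            (frac_laplacian \<sigma> f n0 = 0 \<longrightarrow> (\<forall>n. f n = 0)))
       \<and> (\<forall>f g n0. f \<in> ell2 \<longrightarrow> g \<in> ell2 \<longrightarrow> (\<forall>n. g n \<le> f n) \<longrightarrow> f n0 = g n0 \<longrightarrow>
            frac_laplacian \<sigma> f n0 \<le> frac_laplacian \<sigma> g n0 \<and>
            (frac_laplacian \<sigma> f n0 = frac_laplacian \<sigma> g n0 \<longrightarrow> (\<forall>n. f n = g n)))"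
proof (intro conjI allI impI)
  fix f n0
  assume f: "f \<in> ell2" "\<forall>n. 0 \<le> f n" "f n0 = 0"
  obtain M where M: "\<And>n. \<bar>f n\<bar> \<le> M"
    using ell2_bounded[OF f(1)] by blast
  show "frac_laplacian \<sigma> f n0 \<le> 0"
    using f by (intro frac_laplacian_at_zero_minimum(1)[OF assms M]) auto
  show "f n = 0" if "frac_laplacian \<sigma> f n0 = 0" for n
    using f that by (intro frac_laplacian_at_zero_minimum(2)[OF assms M]) auto
next
  fix f g n0
  assume fg: "f \<in> ell2" "g \<in> ell2" "\<forall>n. g n \<le> f n" "f n0 = g n0"
  obtain M where M: "\<And>n. \<bar>f n\<bar> \<le> M"
    using ell2_bounded[OF fg(1)] by blast
  obtain N where N: "\<And>n. \<bar>g n\<bar> \<le> N"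
    using ell2_bounded[OF fg(2)] by blast
  define h where "h m = f m - g m" for m
  have h: "\<bar>h m\<bar> \<le> M + N" "0 \<le> h m" "h n0 = 0" for m
    using M[of m] N[of m] fg by (auto simp: h_def)
  have diff: "frac_laplacian \<sigma> h n0 = frac_laplacian \<sigma> f n0 - frac_laplacian \<sigma> g n0"
    using frac_laplacian_diff[OF assms M N] by (simp add: h_def[abs_def])
  show "frac_laplacian \<sigma> f n0 \<le> frac_laplacian \<sigma> g n0"
    using frac_laplacian_at_zero_minimum(1)[of \<sigma> h "M + N" n0] assms h by (simp add: diff)
  show "f n = g n" if "frac_laplacian \<sigma> f n0 = frac_laplacian \<sigma> g n0" for n
    using frac_laplacian_at_zero_minimum(2)[of \<sigma> h "M + N" n0 n] assms h that by (simp add: diff h_def)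
qed

end
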